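(* Let $H_{C,N}=(S^1_{T,N}-K)^+$ be European call options with strike $K>0$ in the homogeneous discrete time models described in the context, and let $p_{Q_N}(H_{C,N})$ be the option price computed as expectation of the discounted payoff with respect to the martingale measure $Q_N=\bigotimes_{j=1}^NQ_N(j)$. Then $$p_{Q_N}(H_{C,N})\to p_Q(H_C)\quad\text{as }N\to\infty,$$ where $$p_Q(H_C)=s^1_0\,\Phi(-x+\sigma\sqrt T)-\exp(-rT)K\,\Phi(-x),\qquad x=\frac{1}{\sigma\sqrt T}\left[\log\frac{K}{s^1_0}-rT+\frac{\sigma^2}{2}T\right],$$ is the Black–Scholes price of the European call.
   Context: Fix $0<T<\infty$, constants $\sigma>0$, $r\ge0$, and an initial price $s^1_0>0$. $\Phi$ is the standard normal distribution function. $P_0$ is a probability measure on a measurable space $(\Omega,\mathcal{A})$ and $g\in L_2(P_0)$ satisfies $\int g\,dP_0=0$, $\int g^2\,dP_0=1$, $g>-C$ for some constant $C>0$; $(P_\vartheta)_{0\le\vartheta\le C^{-1}}$ is the path of probability measures with $\frac{dP_\vartheta}{dP_0}=1+\vartheta g$. At stage $N$ the volatility parameter is constant, $\sigma_{k,N}=\sigma$, and the interest rate parameter is $\rho_{k,N}=\rho_N:=\frac NT\left(\exp\left(\frac{rT}{N}\right)-1\right)$ for all $k\le N$. The bond is $S^0_{kT/N,N}=\left(1+\frac{\rho_NT}{N}\right)^k$, so $S^0_{T,N}=\exp(rT)$. The asset price is $$S^1_{kT/N,N}(x_1,\dots,x_k)=s^1_0\prod_{i=1}^k\frac{dP_{\sigma\sqrt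 T/\sqrt N}}{dP_0}(x_i),\qquad 0\le k\le N.$$ For $N$ large enough the one-period martingale measures are $Q_N(j)=P_{\frac{\rho_N}{\sigma}\frac{\sqrt T}{\sqrt N}}$, $1\le j\le N$, $Q_N=\bigotimes_{j=1}^NQ_N(j)$ on $\Omega^N$, and $p_{Q_N}(H)=E_{Q_N}\big((S^0_{T,N})^{-1}H\big)$. *)

theory Defs
  imports "HOL-Probability.Probability"
begin

(* The path only matters for 0 <= \<theta> <= 1/C, where g > -C makes 1 + \<theta> g nonnegative; for larger
   parameters the coercion ennreal truncates the density at 0 and the measure need not be a
   probability measure. The parameters used below are of order 1/sqrt N, so this affects only
   finitely many stages N. *)
definition measure_path :: "'a measure \<Rightarrow> ('a \<Rightarrow> real) \<Rightarrow> real \<Rightarrow> 'a measure" where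
  "measure_path P\<^sub>0 g \<theta> = density P\<^sub>0 (\<lambda>x. ennreal (1 + \<theta> * g x))"

definition interest_rate :: "real \<Rightarrow> real \<Rightarrow> nat \<Rightarrow> real" where
  "interest_rate T r N = real N / T * (exp (r * T / real N) - 1)"

(* Prices are indexed by the step k <= N; step k is the trading date k T / N, so that k = N is
   the maturity T. *)
definition bond_price :: "real \<Rightarrow> real \<Rightarrow> nat \<Rightarrow> nat \<Rightarrow> real" where
  "bond_price T r N k = (1 + interest_rate T r N * T / real N) ^ k"

(* A scenario (x_1, ..., x_N) is a function x on {1..N}. RN_deriv P\<^sub>0 P is the derivative dP/dP\<^sub>0. *)
definition asset_price ::
  "'a measure \<Rightarrow> ('a \<Rightarrow> real) \<Rightarrow> real \<Rightarrow> real \<Rightarrow> real \<Rightarrow> nat \<Rightarrow> nat \<Rightarrow> (nat \<Rightarrow> 'a) \<Rightarrow> real" where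
  "asset_price P\<^sub>0 g s\<^sub>0 \<sigma> T N k x =
     s\<^sub>0 * (\<Prod>i=1..k. enn2real (RN_deriv P\<^sub>0 (measure_path P\<^sub>0 g (\<sigma> * sqrt T / sqrt (real N))) (x i)))"

definition one_period_martingale_measure ::
  "'a measure \<Rightarrow> ('a \<Rightarrow> real) \<Rightarrow> real \<Rightarrow> real \<Rightarrow> real \<Rightarrow> nat \<Rightarrow> nat \<Rightarrow> 'a measure" where
  "one_period_martingale_measure P\<^sub>0 g \<sigma> T r N j =
     measure_path P\<^sub>0 g (interest_rate T r N / \<sigma> * (sqrt T / sqrt (real N)))"

definition martingale_measure ::
  "'a measure \<Rightarrow> ('a \<Rightarrow> real) \<Rightarrow> real \<Rightarrow> real \<Rightarrow> real \<Rightarrow> nat \<Rightarrow> (nat \<Rightarrow> 'a) measure" where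
  "martingale_measure P\<^sub>0 g \<sigma> T r N =
     (\<Pi>\<^sub>M j\<in>{1..N}. one_period_martingale_measure P\<^sub>0 g \<sigma> T r N j)"

definition call_payoff ::
  "'a measure \<Rightarrow> ('a \<Rightarrow> real) \<Rightarrow> real \<Rightarrow> real \<Rightarrow> real \<Rightarrow> real \<Rightarrow> nat \<Rightarrow> (nat \<Rightarrow> 'a) \<Rightarrow> real" where
  "call_payoff P\<^sub>0 g s\<^sub>0 \<sigma> T K N x = max (asset_price P\<^sub>0 g s\<^sub>0 \<sigma> T N N x - K) 0"

definition option_price ::
  "'a measure \<Rightarrow> ('a \<Rightarrow> real) \<Rightarrow> real \<Rightarrow> real \<Rightarrow> real \<Rightarrow> nat \<Rightarrow> ((nat \<Rightarrow> 'a) \<Rightarrow> real) \<Rightarrow> real" where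
  "option_price P\<^sub>0 g \<sigma> T r N H =
     (LINT x | martingale_measure P\<^sub>0 g \<sigma> T r N. inverse (bond_price T r N N) * H x)"

definition std_normal_cdf :: "real \<Rightarrow> real" where
  "std_normal_cdf = cdf std_normal_distribution"

definition black_scholes_call_price :: "real \<Rightarrow> real \<Rightarrow> real \<Rightarrow> real \<Rightarrow> real \<Rightarrow> real" where
  "black_scholes_call_price s\<^sub>0 \<sigma> T r K =
     (let x = 1 / (\<sigma> * sqrt T) * (ln (K / s\<^sub>0) - r * T + \<sigma>\<^sup>2 / 2 * T)
      in s\<^sub>0 * std_normal_cdf (- x + \<sigma> * sqrt T) - exp (- r * T) * K * std_normal_cdf (- x))"

end

theory Submission
  imports Defs "HOL-Real_Asymp.Real_Asymp"
begin

text \<open>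
  Write \<open>a\<close> for the exposure \<open>\<sigma> \<surd>T / \<surd>N\<close> and \<open>b\<close> for the parameter of the one-period
  martingale measure. Under \<open>Q\<^sub>N\<close> the price ratios \<open>1 + a g(x\<^sub>i)\<close> are independent, and because \<open>g\<close>
  has mean 0 and variance 1 under \<open>P\<^sub>0\<close>, each has mean \<open>1 + a b = exp (r T / N)\<close>. Hence the mean of
  the terminal price is exactly \<open>s\<^sub>0 exp (r T)\<close> once \<open>N\<close> is large, and the call price is
  determined by the put price through put-call parity. The put is the better payoff: it is
  a bounded continuous function of the log price, so that its expectation passes to the limit as
  soon as the log price converges in distribution (\<open>call_price_eq\<close>).

  The log price is the sum of the \<open>ln (1 + a g(x\<^sub>i))\<close>, a triangular array for which the
  limit law comes from Levy's continuity theorem (\<open>log_return_weak_conv\<close>). The characteristic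
  function of one summand is the mean of the imaginary power \<open>(1 + a g)\<^sup>i\<^sup>t\<close>. Expand
  \<open>(1 + u)\<^sup>i\<^sup>t = 1 + i t u - (t\<^sup>2 + i t)/2 u\<^sup>2 + o(u\<^sup>2)\<close> and integrate against the density
  \<open>1 + b g\<close>. The linear term meets the tilt \<open>b g\<close> and contributes \<open>i t a b\<close>, the quadratic term
  contributes \<open>- a\<^sup>2 (t\<^sup>2 + i t)/2\<close>, and \<open>N a\<^sup>2 = \<sigma>\<^sup>2 T\<close>, \<open>N a b \<rightarrow> r T\<close>. This is the
  exponent of the normal law with mean \<open>r T - \<sigma>\<^sup>2 T / 2\<close> and variance \<open>\<sigma>\<^sup>2 T\<close>. No moment of \<open>g\<close> beyond
  the second is available for the error term. Since \<open>g\<close> is bounded below, \<open>a g \<ge> - 1/2\<close> for large \<open>N\<close>,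
  and there the quotient of the remainder by \<open>u\<^sup>2\<close> is bounded, which lets dominated convergence with the
  majorant \<open>g\<^sup>2\<close> do the work (\<open>one_period_char_limit\<close>).

  It remains to evaluate the put under the lognormal law by completing the square
  (\<open>lognormal_put_value\<close>) and to undo the parity.
\<close>

section \<open>Second-order expansion of imaginary powers\<close>

text \<open>The power \<open>(1 + u)\<^sup>i\<^sup>t\<close>, that is, the character \<open>iexp (t y)\<close> at the log return \<open>y = ln (1 + u)\<close>.\<close>

definition imag_power :: "real \<Rightarrow> real \<Rightarrow> complex" where
  "imag_power t u = iexp (t * ln (1 + u))"

lemma norm_imag_power [simp]: "cmod (imag_power t u) = 1"
  by (simp add: imag_power_def)

lemma imag_power_0 [simp]: "imag_power t 0 = 1"
  by (simp add: imag_power_def)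

lemma borel_measurable_imag_power [measurable]: "imag_power t \<in> borel_measurable borel"
  unfolding imag_power_def by measurable

lemma ln_add_one_lipschitz:
  fixes u :: real
  assumes "u \<ge> -1/2"
  shows "\<bar>ln (1 + u)\<bar> \<le> 2 * \<bar>u\<bar>"
proof -
  have pos: "1 + u > 0" using assms by simp
  have "ln (1 + u) \<le> u" using ln_le_minus_one[OF pos] by simp
  moreover have "- ln (1 + u) \<le> inverse (1 + u) - 1"
    using ln_le_minus_one[of "inverse (1 + u)"] pos by (simp add: ln_inverse)
  moreover have "inverse (1 + u) - 1 = - u / (1 + u)" using pos by (simp add: field_simps)
  moreover have "- u / (1 + u) \<le> 2 * \<bar>u\<bar>"
  proof -
    have "- u / (1 + u) \<le> \<bar>u\<bar> / (1 + u)" using pos by (intro divide_right_mono) auto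
    also have "\<dots> \<le> \<bar>u\<bar> / (1/2)" using assms pos by (intro divide_left_mono) auto
    finally show ?thesis by simp
  qed
  ultimately show ?thesis by linarith
qed

text \<open>The bound is needed without an upper limit on \<open>u\<close>, as \<open>g\<close> may be
  unbounded above. For \<open>u > 1/2\<close> the left-hand side is at most \<open>u \<le> 2 u\<^sup>2\<close>.\<close>

lemma ln_add_one_quadratic:
  fixes u :: real
  assumes "u \<ge> -1/2"
  shows "\<bar>ln (1 + u) - u\<bar> \<le> 2 * u\<^sup>2"
proof (cases "u \<le> 1/2")
  case True
  then show ?thesis using assms by (intro abs_ln_one_plus_x_minus_x_bound) auto
next
  case False
  then have "0 \<le> ln (1 + u)" "ln (1 + u) \<le> u"
    using ln_le_minus_one[of "1 + u"] by auto
  moreover have "u * 1 \<le> u * (2 * u)" using False by (intro mult_left_mono) auto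
  ultimately show ?thesis by (simp add: power2_eq_square)
qed

lemma imag_power_bound1:
  assumes "u \<ge> -1/2"
  shows "cmod (imag_power t u - 1) \<le> 2 * \<bar>t\<bar> * \<bar>u\<bar>"
proof -
  have "cmod (imag_power t u - 1) \<le> \<bar>t * ln (1 + u)\<bar>"
    using iexp_approx1[of "t * ln (1 + u)" 0] by (simp add: imag_power_def)
  also have "\<dots> \<le> \<bar>t\<bar> * (2 * \<bar>u\<bar>)"
    unfolding abs_mult by (intro mult_left_mono ln_add_one_lipschitz assms) auto
  finally show ?thesis by (simp add: ac_simps)
qed

text \<open>The two sources of error are the quadratic error of the exponential at \<open>t ln (1 + u)\<close>
  and the replacement of \<open>ln (1 + u)\<close> by \<open>u\<close> in its linear term. Both are \<open>O(u\<^sup>2)\<close> uniformly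
  on the whole half-line, which is what domination by \<open>g\<^sup>2\<close> requires.\<close>

lemma imag_power_bound2:
  assumes "u \<ge> -1/2"
  shows "cmod (imag_power t u - 1 - \<i> * t * u) \<le> (2 * t\<^sup>2 + 2 * \<bar>t\<bar>) * u\<^sup>2"
proof -
  define L where "L = ln (1 + u)"
  have "cmod (imag_power t u - 1 - \<i> * (t * L)) \<le> \<bar>t * L\<bar>\<^sup>2 / 2"
    using iexp_approx1[of "t * L" 1]
    by (simp add: imag_power_def L_def algebra_simps eval_nat_numeral)
  also have "\<dots> \<le> (\<bar>t\<bar> * (2 * \<bar>u\<bar>))\<^sup>2 / 2"
    unfolding abs_mult L_def
    by (intro divide_right_mono power_mono mult_left_mono ln_add_one_lipschitz assms) auto
  finally have 1: "cmod (imag_power t u - 1 - \<i> * (t * L)) \<le> 2 * t\<^sup>2 * u\<^sup>2"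
    by (simp add: power_mult_distrib)
  have "cmod (\<i> * t * (L - u)) = \<bar>t\<bar> * \<bar>L - u\<bar>"
    by (simp add: norm_mult del: of_real_diff flip: of_real_diff)
  also have "\<dots> \<le> \<bar>t\<bar> * (2 * u\<^sup>2)"
    unfolding L_def by (intro mult_left_mono ln_add_one_quadratic assms) auto
  finally have 2: "cmod (\<i> * t * (L - u)) \<le> 2 * \<bar>t\<bar> * u\<^sup>2" by (simp add: ac_simps)
  have "imag_power t u - 1 - \<i> * t * u
      = (imag_power t u - 1 - \<i> * (t * L)) + \<i> * t * (L - u)" by (simp add: algebra_simps)
  then have "cmod (imag_power t u - 1 - \<i> * t * u) \<le> 2 * t\<^sup>2 * u\<^sup>2 + 2 * \<bar>t\<bar> * u\<^sup>2"
    using norm_triangle_mono[OF 1 2] by metis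
  then show ?thesis by (simp add: algebra_simps)
qed

lemma imag_power_Re_Im:
  "Re (imag_power t u) = cos (t * ln (1 + u))" "Im (imag_power t u) = sin (t * ln (1 + u))"
  by (simp_all add: imag_power_def Re_exp Im_exp)

lemma imag_power_limit1:
  "((\<lambda>u. (imag_power t u - 1) / of_real u) \<longlongrightarrow> \<i> * t) (at 0)"
proof -
  have "((\<lambda>u. (cos (t * ln (1 + u)) - 1) / u) \<longlongrightarrow> 0) (at 0)"
    by real_asymp
  moreover have "((\<lambda>u. sin (t * ln (1 + u)) / u) \<longlongrightarrow> t) (at 0)"
    by real_asymp
  ultimately show ?thesis
    by (subst tendsto_complex_iff) (simp add: imag_power_Re_Im Re_divide_of_real Im_divide_of_real)
qed

lemma imag_power_limit2:
  "((\<lambda>u. (imag_power t u - 1 - \<i> * t * u) / (of_real u)\<^sup>2) \<longlongrightarrow> - of_real (t\<^sup>2) / 2 - \<i> * t / 2) (at 0)"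
proof -
  have "((\<lambda>u. (cos (t * ln (1 + u)) - 1) / u\<^sup>2) \<longlongrightarrow> - (t * t / 2)) (at 0)"
    by real_asymp
  moreover have "((\<lambda>u. (sin (t * ln (1 + u)) - t * u) / u\<^sup>2) \<longlongrightarrow> - t / 2) (at 0)"
    by real_asymp
  ultimately show ?thesis
    by (subst tendsto_complex_iff)
       (simp add: imag_power_Re_Im Re_divide_of_real Im_divide_of_real power2_eq_square)
qed

section \<open>Powers of characteristic functions\<close>

lemma tendsto_exp_difference_quotient:
  fixes c :: complex
  shows "(\<lambda>n. of_nat n * (exp (c / of_nat n) - 1)) \<longlonglongrightarrow> c"
proof -
  have "((\<lambda>y. (exp (c * y) - 1) / y) \<longlongrightarrow> c) (at 0)"
  proof -
    have "((\<lambda>y. exp (c * y)) has_field_derivative c) (at 0)"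
      by (auto intro!: derivative_eq_intros)
    then show ?thesis by (simp add: has_field_derivative_iff)
  qed
  moreover have "filterlim (\<lambda>n. inverse (of_nat n) :: complex) (at 0) sequentially"
    unfolding filterlim_at
    by (auto intro!: tendsto_inverse_0_at_top tendsto_intros lim_inverse_n eventually_sequentiallyI[of 1])
  ultimately have "(\<lambda>n. (exp (c * inverse (of_nat n)) - 1) / inverse (of_nat n)) \<longlonglongrightarrow> c"
    by (rule filterlim_compose)
  then show ?thesis by (simp add: field_simps)
qed

text \<open>Compare \<open>\<phi> n\<close> with \<open>w n = exp (c / k n)\<close>, whose power is \<open>exp c\<close>: for numbers in the
  closed unit disc the \<open>k\<close>-th powers differ by at most \<open>k\<close> times the difference of the bases, and
  \<open>k n * (\<phi> n - 1)\<close> and \<open>k n * (w n - 1)\<close> have the same limit. The condition \<open>Re c \<le> 0\<close>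
  puts \<open>w n\<close> into the disc.\<close>

lemma tendsto_power_exp:
  fixes \<phi> :: "nat \<Rightarrow> complex"
  assumes k: "filterlim k at_top sequentially"
    and \<phi>: "\<And>n. cmod (\<phi> n) \<le> 1"
    and lim: "(\<lambda>n. of_nat (k n) * (\<phi> n - 1)) \<longlonglongrightarrow> c"
    and c: "Re c \<le> 0"
  shows "(\<lambda>n. \<phi> n ^ k n) \<longlonglongrightarrow> exp c"
proof -
  define w where "w n = exp (c / of_nat (k n))" for n
  have w: "cmod (w n) \<le> 1" for n
    using c by (simp add: w_def divide_nonpos_nonneg)
  have "(\<lambda>n. of_nat (k n) * (w n - 1)) \<longlonglongrightarrow> c"
    unfolding w_def by (rule filterlim_compose[OF tendsto_exp_difference_quotient k])
  then have "(\<lambda>n. of_nat (k n) * (\<phi> n - 1) - of_nat (k n) * (w n - 1)) \<longlonglongrightarrow> c - c"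
    by (intro tendsto_diff lim)
  then have "(\<lambda>n. cmod (of_nat (k n) * (\<phi> n - w n))) \<longlonglongrightarrow> 0"
    by (intro tendsto_norm_zero) (simp add: algebra_simps)
  then have "(\<lambda>n. \<phi> n ^ k n - w n ^ k n) \<longlonglongrightarrow> 0"
    by (rule Lim_null_comparison[rotated])
       (auto intro!: always_eventually norm_power_diff \<phi> w simp: norm_mult)
  moreover have "eventually (\<lambda>n. w n ^ k n = exp c) sequentially"
    using eventually_compose_filterlim[OF eventually_gt_at_top[of 0] k]
    by eventually_elim (simp add: w_def flip: exp_of_nat_mult)
  then have "(\<lambda>n. w n ^ k n) \<longlonglongrightarrow> exp c" by (rule tendsto_eventually)
  ultimately show ?thesis
    using tendsto_add by fastforce
qed


section \<open>Measures with affine densities\<close>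

text \<open>In statistics, \<open>g\<close> is the score of the path \<open>\<theta> \<mapsto> (1 + \<theta> g) P\<^sub>0\<close> at \<open>\<theta> = 0\<close>. The lower bound is
  imposed everywhere, not only almost everywhere, so that for small \<open>\<theta> \<ge> 0\<close> the density
  is pointwise positive and logarithms of products split without null-set arguments.\<close>

locale score = prob_space +
  fixes g :: "'a \<Rightarrow> real" and C :: real
  assumes score_measurable [measurable]: "g \<in> borel_measurable M"
    and score_square_integrable: "integrable M (\<lambda>x. (g x)\<^sup>2)"
    and score_mean: "expectation g = 0"
    and score_variance: "expectation (\<lambda>x. (g x)\<^sup>2) = 1"
    and score_lower: "\<And>x. - C \<le> g x"
begin

lemma score_integrable [intro]: "integrable M g"
  using score_square_integrable by (rule square_integrable_imp_integrable[rotated]) measurable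

lemma scaled_score_lower:
  assumes "0 \<le> \<theta>" "\<theta> * C \<le> c"
  shows "- c \<le> \<theta> * g x"
proof -
  have "\<theta> * (- C) \<le> \<theta> * g x" by (intro mult_left_mono score_lower assms)
  then show ?thesis using assms by simp
qed

lemma sets_path [measurable_cong, simp]: "sets (measure_path M g \<theta>) = sets M"
  by (simp add: measure_path_def)

lemma
  fixes f :: "'a \<Rightarrow> 'b::{banach, second_countable_topology}"
  assumes \<theta>: "0 \<le> \<theta>" "\<theta> * C \<le> 1" and f [measurable]: "f \<in> borel_measurable M"
  shows integral_path:
      "integral\<^sup>L (measure_path M g \<theta>) f = (LINT x|M. (1 + \<theta> * g x) *\<^sub>R f x)"
    and integrable_path_iff:
      "integrable (measure_path M g \<theta>) f \<longleftrightarrow> integrable M (\<lambda>x. (1 + \<theta> * g x) *\<^sub>R f x)"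
proof -
  have nn: "AE x in M. 0 \<le> 1 + \<theta> * g x"
  proof (rule AE_I2)
    show "0 \<le> 1 + \<theta> * g x" for x using scaled_score_lower[OF \<theta>, of x] by simp
  qed
  show "integral\<^sup>L (measure_path M g \<theta>) f = (LINT x|M. (1 + \<theta> * g x) *\<^sub>R f x)"
    unfolding measure_path_def using nn by (subst integral_density) auto
  show "integrable (measure_path M g \<theta>) f \<longleftrightarrow> integrable M (\<lambda>x. (1 + \<theta> * g x) *\<^sub>R f x)"
    unfolding measure_path_def using nn by (subst integrable_density) auto
qed

lemma prob_space_path:
  assumes \<theta>: "0 \<le> \<theta>" "\<theta> * C \<le> 1"
  shows "prob_space (measure_path M g \<theta>)"
proof
  have nn: "0 \<le> 1 + \<theta> * g x" for x
    using scaled_score_lower[OF \<theta>, of x] by simp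
  have "emeasure (measure_path M g \<theta>) (space (measure_path M g \<theta>))
      = (\<integral>\<^sup>+ x. ennreal (1 + \<theta> * g x) \<partial>M)"
    by (simp add: measure_path_def emeasure_density cong: nn_integral_cong)
  also have "\<dots> = ennreal (LINT x|M. 1 + \<theta> * g x)"
    by (intro nn_integral_eq_integral) (auto intro!: score_integrable simp: nn)
  also have "(LINT x|M. 1 + \<theta> * g x) = 1"
    by (simp add: score_integrable score_mean prob_space)
  finally show "emeasure (measure_path M g \<theta>) (space (measure_path M g \<theta>)) = 1" by simp
qed

lemma AE_path: "AE x in M. P x \<Longrightarrow> AE x in measure_path M g \<theta>. P x"
  unfolding measure_path_def by (subst AE_density) auto

lemma RN_deriv_path:
  assumes \<theta>: "0 \<le> \<theta>" "\<theta> * C \<le> 1"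
  shows "AE x in M. enn2real (RN_deriv M (measure_path M g \<theta>) x) = 1 + \<theta> * g x"
proof -
  have "AE x in M. ennreal (1 + \<theta> * g x) = RN_deriv M (measure_path M g \<theta>) x"
    by (rule RN_deriv_unique) (auto simp: measure_path_def)
  then show ?thesis
  proof eventually_elim
    case (elim x)
    have "0 \<le> 1 + \<theta> * g x" using scaled_score_lower[OF \<theta>, of x] by simp
    then show ?case using elim by (metis enn2real_ennreal)
  qed
qed

text \<open>\<open>E[(1 + \<theta> g) (1 + a g)] = 1 + a \<theta>\<close>, by \<open>E[g] = 0\<close> and \<open>E[g\<^sup>2] = 1\<close>. Choosing \<open>\<theta>\<close> so that this
  equals the one-period bond growth is what makes the tilted measure a martingale measure.\<close>

lemma mean_price_ratio:
  assumes \<theta>: "0 \<le> \<theta>" "\<theta> * C \<le> 1"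
  shows "integrable (measure_path M g \<theta>) (\<lambda>x. 1 + a * g x)"
    and "(LINT x|measure_path M g \<theta>. 1 + a * g x) = 1 + a * \<theta>"
proof -
  have eq: "(1 + \<theta> * g x) *\<^sub>R (1 + a * g x) = 1 + (\<theta> + a) * g x + a * \<theta> * (g x)\<^sup>2" for x
    by (simp add: algebra_simps power2_eq_square)
  show "integrable (measure_path M g \<theta>) (\<lambda>x. 1 + a * g x)"
    unfolding integrable_path_iff[OF \<theta>, of "\<lambda>x. 1 + a * g x", simplified] real_scaleR_def
    using score_integrable score_square_integrable
    by (subst eq[unfolded real_scaleR_def]) auto
  show "(LINT x|measure_path M g \<theta>. 1 + a * g x) = 1 + a * \<theta>"
    using score_integrable score_square_integrable
    by (subst integral_path[OF \<theta>]) (auto simp: eq score_mean score_variance prob_space simp del: real_scaleR_def)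
qed

section \<open>Convergence of the log price\<close>

text \<open>Dominated convergence with majorant \<open>B g\<^sup>2\<close>, in the form needed for both orders of the
  expansion: \<open>R\<close> is a Taylor remainder divided by its power of \<open>u\<close>, continued to \<open>u = 0\<close> by its limit.\<close>

lemma weighted_remainder_limit:
  fixes R :: "real \<Rightarrow> complex"
  assumes [measurable]: "R \<in> borel_measurable borel"
    and cont: "(R \<longlongrightarrow> R 0) (at 0)"
    and bound: "\<And>u. u \<ge> -1/2 \<Longrightarrow> cmod (R u) \<le> B"
    and a: "\<And>n. 0 \<le> a n" "\<And>n. a n * C \<le> 1/2" "a \<longlonglongrightarrow> 0"
  shows "integrable M (\<lambda>x. (g x)\<^sup>2 *\<^sub>R R (a n * g x))"
    and "(\<lambda>n. LINT x|M. (g x)\<^sup>2 *\<^sub>R R (a n * g x)) \<longlonglongrightarrow> R 0"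
proof -
  have le: "norm ((g x)\<^sup>2 *\<^sub>R R (a n * g x)) \<le> (g x)\<^sup>2 * B" for n x
    using bound[of "a n * g x"] scaled_score_lower[OF a(1,2), of n x]
    by (auto intro!: mult_left_mono)
  have int: "integrable M (\<lambda>x. (g x)\<^sup>2 * B)"
    by (intro integrable_mult_left score_square_integrable)
  show "integrable M (\<lambda>x. (g x)\<^sup>2 *\<^sub>R R (a n * g x))"
    by (rule Bochner_Integration.integrable_bound[OF int])
       (use le in \<open>auto intro!: AE_I2 intro: order_trans[OF _ abs_ge_self]\<close>)
  have "(\<lambda>n. R (a n * g x)) \<longlonglongrightarrow> R 0" for x
  proof (rule isCont_tendsto_compose[of 0 R])
    show "isCont R 0" using cont by (simp add: isCont_def)
    show "(\<lambda>n. a n * g x) \<longlonglongrightarrow> 0" using a(3) by (rule tendsto_mult_left_zero)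
  qed
  then have "(\<lambda>n. LINT x|M. (g x)\<^sup>2 *\<^sub>R R (a n * g x)) \<longlonglongrightarrow> (LINT x|M. (g x)\<^sup>2 *\<^sub>R R 0)"
    using le int
    by (intro integral_dominated_convergence[where w = "\<lambda>x. (g x)\<^sup>2 * B"])
       (auto intro!: AE_I2 tendsto_intros)
  then show "(\<lambda>n. LINT x|M. (g x)\<^sup>2 *\<^sub>R R (a n * g x)) \<longlonglongrightarrow> R 0"
    using score_square_integrable score_variance by simp
qed

text \<open>The limit is \<open>v \<cdot> it(it - 1)/2 + d \<cdot> it\<close>. The tilt enters only through \<open>k a b\<close>: for the
  constant density 1 the linear term of \<open>(1 + a g)\<^sup>i\<^sup>t\<close> integrates to zero and only the second-order term
  survives, whereas the part \<open>b g\<close> of the density already carries one factor \<open>g\<close> and needs the first order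
  only.\<close>

lemma one_period_char_limit:
  fixes a b :: "nat \<Rightarrow> real" and k :: "nat \<Rightarrow> nat" and t :: real
  assumes a: "\<And>n. 0 \<le> a n" "\<And>n. a n * C \<le> 1/2" "a \<longlonglongrightarrow> 0"
    and b: "\<And>n. 0 \<le> b n" "\<And>n. b n * C \<le> 1"
    and variance: "(\<lambda>n. k n * (a n)\<^sup>2) \<longlonglongrightarrow> v"
    and drift: "(\<lambda>n. k n * (a n * b n)) \<longlonglongrightarrow> d"
  defines "\<phi> \<equiv> \<lambda>n. LINT x|measure_path M g (b n). imag_power t (a n * g x)"
  shows "(\<lambda>n. of_nat (k n) * (\<phi> n - 1)) \<longlonglongrightarrow> of_real v * (- of_real (t\<^sup>2) / 2 - \<i> * t / 2) + of_real d * (\<i> * t)"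
proof -
  define R\<^sub>1 where "R\<^sub>1 u = (if u = 0 then \<i> * t else (imag_power t u - 1) / of_real u)" for u
  define R\<^sub>2 where "R\<^sub>2 u = (if u = 0 then - of_real (t\<^sup>2) / 2 - \<i> * t / 2
      else (imag_power t u - 1 - \<i> * t * u) / (of_real u)\<^sup>2)" for u
  have [measurable]: "R\<^sub>1 \<in> borel_measurable borel" "R\<^sub>2 \<in> borel_measurable borel"
    unfolding R\<^sub>1_def R\<^sub>2_def by measurable
  have R1: "imag_power t u - 1 = u *\<^sub>R R\<^sub>1 u" for u
    by (simp add: R\<^sub>1_def scaleR_conv_of_real)
  have R2: "imag_power t u - 1 - \<i> * t * u = u\<^sup>2 *\<^sub>R R\<^sub>2 u" for u
    by (simp add: R\<^sub>2_def scaleR_conv_of_real)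
  have R1_bound: "cmod (R\<^sub>1 u) \<le> 2 * \<bar>t\<bar>" if "u \<ge> -1/2" for u
    using imag_power_bound1[OF that, of t]
    by (auto simp: R\<^sub>1_def norm_mult norm_divide divide_le_eq)
  have R2_bound: "cmod (R\<^sub>2 u) \<le> 2 * t\<^sup>2 + 2 * \<bar>t\<bar>" if "u \<ge> -1/2" for u
  proof (cases "u = 0")
    case True
    have "cmod (- of_real (t\<^sup>2) / 2 - \<i> * t / 2) \<le> cmod (- of_real (t\<^sup>2) / 2) + cmod (\<i> * t / 2)"
      by (rule norm_triangle_ineq4)
    also have "\<dots> = t\<^sup>2 / 2 + \<bar>t\<bar> / 2" by (simp add: norm_mult norm_divide norm_power)
    also have "\<dots> \<le> 2 * t\<^sup>2 + 2 * \<bar>t\<bar>"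
      using zero_le_power2[of t] abs_ge_zero[of t] by linarith
    finally show ?thesis using True by (simp add: R\<^sub>2_def)
  next
    case False
    then show ?thesis using imag_power_bound2[OF that, of t]
      by (simp add: R\<^sub>2_def norm_mult norm_divide norm_power divide_le_eq)
  qed
  \<comment> \<open>The value assigned at 0 does not affect the punctured limit there.\<close>
  have cong: "((\<lambda>u. if u = 0 then c else F u) \<longlongrightarrow> l) (at 0)" if "(F \<longlongrightarrow> l) (at 0)"
    for F :: "real \<Rightarrow> complex" and c l
    by (rule Lim_transform_eventually[OF that]) (auto simp: eventually_at_filter)
  have "(R\<^sub>1 \<longlongrightarrow> R\<^sub>1 0) (at 0)" "(R\<^sub>2 \<longlongrightarrow> R\<^sub>2 0) (at 0)"
    unfolding R\<^sub>1_def R\<^sub>2_def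
    by (auto intro!: cong imag_power_limit1 imag_power_limit2[simplified])
  note W1 = weighted_remainder_limit[OF _ this(1) R1_bound a, simplified]
   and W2 = weighted_remainder_limit[OF _ this(2) R2_bound a, simplified]
  define I\<^sub>1 where "I\<^sub>1 n = (LINT x|M. (g x)\<^sup>2 *\<^sub>R R\<^sub>1 (a n * g x))" for n
  define I\<^sub>2 where "I\<^sub>2 n = (LINT x|M. (g x)\<^sup>2 *\<^sub>R R\<^sub>2 (a n * g x))" for n
  have \<phi>: "\<phi> n - 1 = (a n)\<^sup>2 *\<^sub>R I\<^sub>2 n + (a n * b n) *\<^sub>R I\<^sub>1 n" for n
  proof -
    have eq: "(1 + b n * g x) *\<^sub>R (imag_power t (a n * g x) - 1)
        = (g x * a n) *\<^sub>R (\<i> * t) + (a n)\<^sup>2 *\<^sub>R ((g x)\<^sup>2 *\<^sub>R R\<^sub>2 (a n * g x))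
          + (a n * b n) *\<^sub>R ((g x)\<^sup>2 *\<^sub>R R\<^sub>1 (a n * g x))" for x
    proof -
      have "imag_power t (a n * g x) - 1 = \<i> * t * (a n * g x) + (a n * g x)\<^sup>2 *\<^sub>R R\<^sub>2 (a n * g x)"
        using R2[of "a n * g x"] by (simp add: algebra_simps)
      moreover have "(b n * g x) *\<^sub>R (imag_power t (a n * g x) - 1)
          = (b n * g x) *\<^sub>R ((a n * g x) *\<^sub>R R\<^sub>1 (a n * g x))"
        by (simp only: R1)
      ultimately show ?thesis
        by (simp add: scaleR_left_distrib power_mult_distrib power2_eq_square ac_simps)
           (simp add: scaleR_conv_of_real ac_simps)
    qed
    interpret Q: prob_space "measure_path M g (b n)" by (rule prob_space_path[OF b])
    have int: "integrable (measure_path M g (b n)) (\<lambda>x. imag_power t (a n * g x))"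
      by (rule Q.integrable_const_bound[where B = 1]) auto
    have "\<phi> n - 1 = (LINT x|measure_path M g (b n). imag_power t (a n * g x) - 1)"
      unfolding \<phi>_def using int by (simp add: Q.prob_space)
    also have "\<dots> = (LINT x|M. (1 + b n * g x) *\<^sub>R (imag_power t (a n * g x) - 1))"
      by (rule integral_path[OF b]) measurable
    also have "\<dots> = (a n)\<^sup>2 *\<^sub>R I\<^sub>2 n + (a n * b n) *\<^sub>R I\<^sub>1 n"
      unfolding eq I\<^sub>1_def I\<^sub>2_def using W1(1)[of n] W2(1)[of n] score_integrable
      by (simp add: score_mean del: scaleR_scaleR)
    finally show ?thesis .
  qed
  have "(\<lambda>n. (k n * (a n)\<^sup>2) *\<^sub>R I\<^sub>2 n + (k n * (a n * b n)) *\<^sub>R I\<^sub>1 n) \<longlonglongrightarrow> v *\<^sub>R R\<^sub>2 0 + d *\<^sub>R R\<^sub>1 0"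
    using W1(2) W2(2) unfolding I\<^sub>1_def I\<^sub>2_def by (intro tendsto_intros variance drift)
  also have "(\<lambda>n. (k n * (a n)\<^sup>2) *\<^sub>R I\<^sub>2 n + (k n * (a n * b n)) *\<^sub>R I\<^sub>1 n)
      = (\<lambda>n. of_nat (k n) * (\<phi> n - 1))"
    by (simp add: \<phi> fun_eq_iff scaleR_conv_of_real algebra_simps)
  finally show ?thesis by (simp add: R\<^sub>1_def R\<^sub>2_def scaleR_conv_of_real)
qed

text \<open>The log price relative to the initial price, as a function of the scenario.\<close>

definition log_return :: "real \<Rightarrow> nat \<Rightarrow> (nat \<Rightarrow> 'a) \<Rightarrow> real" where
  "log_return a k x = (\<Sum>i=1..k. ln (1 + a * g (x i)))"

lemma log_return_measurable [measurable]:
  "log_return a k \<in> borel_measurable (\<Pi>\<^sub>M j\<in>{1..k}. measure_path M g \<theta>)"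
  unfolding log_return_def by measurable

lemma product_path:
  assumes \<theta>: "0 \<le> \<theta>" "\<theta> * C \<le> 1"
  shows "product_prob_space (\<lambda>_. measure_path M g \<theta>)"
  using prob_space_path[OF \<theta>]
  by (simp add: product_prob_space_def product_sigma_finite_def product_prob_space_axioms_def
      prob_space_imp_sigma_finite)

lemma char_log_return:
  assumes \<theta>: "0 \<le> \<theta>" "\<theta> * C \<le> 1"
  shows "char (distr (\<Pi>\<^sub>M j\<in>{1..k}. measure_path M g \<theta>) borel (log_return a k)) t
    = (LINT x|measure_path M g \<theta>. imag_power t (a * g x)) ^ k"
proof -
  interpret Q: prob_space "measure_path M g \<theta>" by (rule prob_space_path[OF \<theta>])
  interpret P: product_prob_space "\<lambda>_::nat. measure_path M g \<theta>" "{1..k}" by (rule product_path[OF \<theta>])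
  have eq: "iexp (t * log_return a k x) = (\<Prod>i\<in>{1..k}. imag_power t (a * g (x i)))" for x
    by (simp add: log_return_def imag_power_def sum_distrib_left exp_sum)
  have "char (distr (\<Pi>\<^sub>M j\<in>{1..k}. measure_path M g \<theta>) borel (log_return a k)) t
      = (LINT x|(\<Pi>\<^sub>M j\<in>{1..k}. measure_path M g \<theta>). (\<Prod>i\<in>{1..k}. imag_power t (a * g (x i))))"
    unfolding char_def by (subst integral_distr[OF log_return_measurable]) (simp_all only: eq, measurable)
  also have "\<dots> = (\<Prod>i\<in>{1..k}. LINT x|measure_path M g \<theta>. imag_power t (a * g x))"
    by (rule P.product_integral_prod) (auto intro!: Q.integrable_const_bound[where B = 1])
  finally show ?thesis by simp
qed

lemma char_affine_std_normal:
  "char (distr std_normal_distribution borel (\<lambda>z. m + s * z)) t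
    = exp (\<i> * (t * m) - of_real ((s * t)\<^sup>2) / 2)"
proof -
  have "char (distr std_normal_distribution borel (\<lambda>z. m + s * z)) t
      = (LINT z|std_normal_distribution. iexp (t * m) * iexp ((s * t) * z))"
    unfolding char_def by (subst integral_distr) (simp_all add: algebra_simps flip: exp_add)
  also have "\<dots> = iexp (t * m) * char std_normal_distribution (s * t)"
    unfolding char_def by (rule integral_mult_right_zero)
  also have "char std_normal_distribution (s * t) = exp (- of_real ((s * t)\<^sup>2) / 2)"
    by (simp add: char_std_normal_distribution flip: exp_of_real)
  also have "iexp (t * m) * \<dots> = exp (\<i> * (t * m) - of_real ((s * t)\<^sup>2) / 2)"
    by (simp flip: exp_add)
  finally show ?thesis .
qed

text \<open>A central limit theorem for the triangular array of log returns. The \<open>- s\<^sup>2 / 2\<close> in the mean is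
  the second-order term of the logarithm.\<close>

theorem log_return_weak_conv:
  fixes a b :: "nat \<Rightarrow> real" and k :: "nat \<Rightarrow> nat"
  assumes a: "\<And>n. 0 \<le> a n" "\<And>n. a n * C \<le> 1/2" "a \<longlonglongrightarrow> 0"
    and b: "\<And>n. 0 \<le> b n" "\<And>n. b n * C \<le> 1"
    and k: "filterlim k at_top sequentially"
    and variance: "(\<lambda>n. k n * (a n)\<^sup>2) \<longlonglongrightarrow> s\<^sup>2"
    and drift: "(\<lambda>n. k n * (a n * b n)) \<longlonglongrightarrow> d"
  shows "weak_conv_m (\<lambda>n. distr (\<Pi>\<^sub>M j\<in>{1..k n}. measure_path M g (b n)) borel (log_return (a n) (k n)))
      (distr std_normal_distribution borel (\<lambda>z. d - s\<^sup>2 / 2 + s * z))"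
proof (rule levy_continuity)
  fix n
  interpret P: product_prob_space "\<lambda>_::nat. measure_path M g (b n)" "{1..k n}"
    by (rule product_path[OF b])
  show "real_distribution (distr (\<Pi>\<^sub>M j\<in>{1..k n}. measure_path M g (b n)) borel (log_return (a n) (k n)))"
    by (rule P.P.real_distribution_distr) measurable
next
  interpret N: real_distribution std_normal_distribution by (rule real_dist_normal_dist)
  show "real_distribution (distr std_normal_distribution borel (\<lambda>z. d - s\<^sup>2 / 2 + s * z))"
    by (rule N.real_distribution_distr) measurable
next
  fix t :: real
  define c where "c = of_real (s\<^sup>2) * (- of_real (t\<^sup>2) / 2 - \<i> * t / 2) + of_real d * (\<i> * t)"
  define \<phi> where "\<phi> n = (LINT x|measure_path M g (b n). imag_power t (a n * g x))" for n
  have "cmod (\<phi> n) \<le> 1" for n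
  proof -
    interpret Q: prob_space "measure_path M g (b n)" by (rule prob_space_path[OF b])
    have "cmod (\<phi> n) \<le> (LINT x|measure_path M g (b n). cmod (imag_power t (a n * g x)))"
      unfolding \<phi>_def by (rule integral_norm_bound)
    then show ?thesis by (simp add: Q.prob_space)
  qed
  moreover have "(\<lambda>n. of_nat (k n) * (\<phi> n - 1)) \<longlonglongrightarrow> c"
    unfolding \<phi>_def c_def by (rule one_period_char_limit[OF a b variance drift])
  moreover have "Re c \<le> 0" by (simp add: c_def)
  ultimately have "(\<lambda>n. \<phi> n ^ k n) \<longlonglongrightarrow> exp c" by (rule tendsto_power_exp[OF k])
  moreover have c_eq: "\<i> * (t * (d - s\<^sup>2 / 2)) - of_real ((s * t)\<^sup>2) / 2 = c"
    by (simp add: c_def field_simps power_mult_distrib)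
  ultimately show "(\<lambda>n. char (distr (\<Pi>\<^sub>M j\<in>{1..k n}. measure_path M g (b n)) borel (log_return (a n) (k n))) t)
      \<longlonglongrightarrow> char (distr std_normal_distribution borel (\<lambda>z. d - s\<^sup>2 / 2 + s * z)) t"
    by (simp only: char_log_return[OF b] char_affine_std_normal c_eq flip: \<phi>_def)
qed

end


section \<open>The Black--Scholes put value\<close>

lemma std_normal_cdf_integral:
  "std_normal_cdf y = (LBINT z. indicator {..y} z * std_normal_density z)"
proof -
  interpret N: real_distribution std_normal_distribution by (rule real_dist_normal_dist)
  have "std_normal_cdf y = (LINT z|std_normal_distribution. indicator {..y} z)"
    by (simp add: std_normal_cdf_def cdf_def)
  also have "\<dots> = (LBINT z. indicator {..y} z * std_normal_density z)"
    by (subst integral_density) (auto simp: ac_simps)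
  finally show ?thesis .
qed

lemma integrable_indicator_std_normal_density:
  "integrable lborel (\<lambda>z. indicator {..y} z * std_normal_density (z - c))"
proof -
  have "integrable lborel (normal_density c 1)"
    by (rule integrable_normal_density) simp
  then have "integrable lborel (\<lambda>z. std_normal_density (z - c))"
    by (simp add: normal_density_def[abs_def])
  then show ?thesis
    using integrable_real_mult_indicator[of "{..y}" lborel "\<lambda>z. std_normal_density (z - c)"]
    by (simp add: mult.commute)
qed

lemma std_normal_cdf_uminus: "std_normal_cdf (- y) = 1 - std_normal_cdf y"
proof -
  have "std_normal_cdf (- y) = (LBINT z. indicator {..- y} (- z) * std_normal_density (- z))"
    unfolding std_normal_cdf_integral
    by (subst lborel_integral_real_affine[where c = "-1" and t = 0]) auto
  also have "\<dots> = (LBINT z. std_normal_density z - indicator {..y} z * std_normal_density z)"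
  proof (rule integral_cong_AE)
    show "AE z in lborel. indicator {..- y} (- z) * std_normal_density (- z)
        = std_normal_density z - indicator {..y} z * std_normal_density z"
      using AE_lborel_singleton[of y]
      by eventually_elim (auto simp: std_normal_density_def split: split_indicator)
  qed measurable
  also have "\<dots> = 1 - std_normal_cdf y"
    unfolding std_normal_cdf_integral
    using integrable_indicator_std_normal_density[of y 0]
    by (subst Bochner_Integration.integral_diff) (auto simp: integral_normal_density)
  finally show ?thesis .
qed

text \<open>Completing the square: \<open>s z - z\<^sup>2/2 = s\<^sup>2/2 - (z - s)\<^sup>2/2\<close>.\<close>

lemma exp_std_normal_density:
  "exp (s * z) * std_normal_density z = exp (s\<^sup>2 / 2) * std_normal_density (z - s)"
proof -
  have "exp (s * z) * exp (- z\<^sup>2 / 2) = exp (s\<^sup>2 / 2) * exp (- (z - s)\<^sup>2 / 2)"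
    by (simp add: power2_eq_square field_simps flip: exp_add)
  then show ?thesis by (simp add: std_normal_density_def)
qed

text \<open>The put is exercised exactly for \<open>z \<le> y\<close>. The strike part then gives \<open>K \<Phi>(y)\<close>, and the price
  part is a Gaussian integral with exponential weight, which amounts to a shift of the mean by \<open>s\<close>.\<close>

lemma lognormal_put_value:
  fixes s s\<^sub>0 K m :: real
  assumes "s > 0" "s\<^sub>0 > 0" "K > 0"
  defines "y \<equiv> (ln (K / s\<^sub>0) - m) / s"
  shows "(LINT z|std_normal_distribution. max (K - s\<^sub>0 * exp (m + s * z)) 0)
    = K * std_normal_cdf y - s\<^sub>0 * exp (m + s\<^sup>2 / 2) * std_normal_cdf (y - s)"
proof -
  have exercise: "s\<^sub>0 * exp (m + s * z) \<le> K \<longleftrightarrow> z \<le> y" for z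
  proof -
    have "s\<^sub>0 * exp (m + s * z) \<le> K \<longleftrightarrow> exp (m + s * z) \<le> K / s\<^sub>0"
      using assms by (simp add: field_simps)
    also have "\<dots> \<longleftrightarrow> m + s * z \<le> ln (K / s\<^sub>0)"
      using assms by (simp add: ln_ge_iff)
    also have "\<dots> \<longleftrightarrow> z \<le> y" using assms by (simp add: y_def field_simps)
    finally show ?thesis .
  qed
  have "(LINT z|std_normal_distribution. max (K - s\<^sub>0 * exp (m + s * z)) 0)
      = (LBINT z. std_normal_density z * max (K - s\<^sub>0 * exp (m + s * z)) 0)"
    by (subst integral_density) auto
  also have "\<dots> = (LBINT z. K * (indicator {..y} z * std_normal_density (z - 0))
      - s\<^sub>0 * exp (m + s\<^sup>2 / 2) * (indicator {..y} z * std_normal_density (z - s)))"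
  proof (rule Bochner_Integration.integral_cong[OF refl])
    fix z
    have "s\<^sub>0 * exp (m + s * z) * std_normal_density z
        = s\<^sub>0 * exp m * (exp (s * z) * std_normal_density z)" by (simp add: exp_add)
    also have "\<dots> = s\<^sub>0 * exp (m + s\<^sup>2 / 2) * std_normal_density (z - s)"
      unfolding exp_std_normal_density by (simp add: exp_add)
    finally show "std_normal_density z * max (K - s\<^sub>0 * exp (m + s * z)) 0
        = K * (indicator {..y} z * std_normal_density (z - 0))
          - s\<^sub>0 * exp (m + s\<^sup>2 / 2) * (indicator {..y} z * std_normal_density (z - s))"
      using exercise[of z] by (auto simp: max_def algebra_simps split: split_indicator)
  qed
  also have "\<dots> = K * (LBINT z. indicator {..y} z * std_normal_density (z - 0))
      - s\<^sub>0 * exp (m + s\<^sup>2 / 2) * (LBINT z. indicator {..y} z * std_normal_density (z - s))"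
    using integrable_indicator_std_normal_density[of y 0]
      integrable_indicator_std_normal_density[of y s] by (subst Bochner_Integration.integral_diff) auto
  also have "(LBINT z. indicator {..y} z * std_normal_density (z - s)) = std_normal_cdf (y - s)"
    unfolding std_normal_cdf_integral
    by (subst lborel_integral_real_affine[where c = 1 and t = s])
       (auto intro!: Bochner_Integration.integral_cong split: split_indicator)
  finally show ?thesis by (simp add: std_normal_cdf_integral)
qed

section \<open>Option prices in the discrete models\<close>

definition market_exposure :: "real \<Rightarrow> real \<Rightarrow> nat \<Rightarrow> real" where
  "market_exposure \<sigma> T N = \<sigma> * sqrt T / sqrt (real N)"

definition martingale_tilt :: "real \<Rightarrow> real \<Rightarrow> real \<Rightarrow> nat \<Rightarrow> real" where
  "martingale_tilt \<sigma> T r N = interest_rate T r N / \<sigma> * (sqrt T / sqrt (real N))"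

context score
begin

text \<open>Put-call parity: \<open>(S - K)\<^sup>+ = S - K + (K - S)\<^sup>+\<close>, and the discounted mean of \<open>S\<close> is \<open>s\<^sub>0\<close> by the
  martingale property. The bounds on \<open>a\<close> and \<open>b\<close> hold for all large \<open>N\<close>; they ensure
  that the densities are nonnegative and the price ratios positive.\<close>

lemma call_price_eq:
  fixes \<sigma> T r s\<^sub>0 K :: real and N :: nat
  defines "a \<equiv> market_exposure \<sigma> T N" and "b \<equiv> martingale_tilt \<sigma> T r N"
  assumes N: "N > 0" and pos: "T > 0" "\<sigma> > 0" "s\<^sub>0 > 0"
    and a: "0 \<le> a" "a * C \<le> 1/2" and b: "0 \<le> b" "b * C \<le> 1"
  shows "option_price M g \<sigma> T r N (call_payoff M g s\<^sub>0 \<sigma> T K N)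
    = s\<^sub>0 - exp (- r * T) * K + exp (- r * T) *
        (LINT x|(\<Pi>\<^sub>M j\<in>{1..N}. measure_path M g b). max (K - s\<^sub>0 * exp (log_return a N x)) 0)"
proof -
  define Q where "Q = measure_path M g b"
  define P where "P = (\<Pi>\<^sub>M j\<in>{1..N}. Q)"
  interpret Q: prob_space Q unfolding Q_def by (rule prob_space_path[OF b])
  interpret P: product_prob_space "\<lambda>_::nat. Q" "{1..N}" unfolding Q_def by (rule product_path[OF b])
  interpret P': prob_space P unfolding P_def by (rule P.P.prob_space_axioms)
  have period: "1 + interest_rate T r N * T / real N = exp (r * T / N)"
    using N pos by (simp add: interest_rate_def)
  have bond: "bond_price T r N N = exp (r * T)"
    using N by (simp add: bond_price_def period flip: exp_of_nat_mult)
  have "a * b = interest_rate T r N * T / real N"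
    using N pos by (simp add: a_def b_def market_exposure_def martingale_tilt_def field_simps)
  then have ab: "1 + a * b = exp (r * T / N)" using period by simp
  have [measurable]: "log_return a N \<in> borel_measurable P"
    unfolding P_def Q_def by measurable
  have a1: "a * C \<le> 1" using a by simp
  have gpos: "1 + a * g x > 0" for x using scaled_score_lower[OF a, of x] by simp
  have exp_log_return: "exp (log_return a N x) = (\<Prod>i\<in>{1..N}. 1 + a * g (x i))" for x
    using gpos by (simp add: log_return_def exp_sum)
  \<comment> \<open>The Radon--Nikodym derivative is determined only up to a null set of \<open>M\<close>, hence of \<open>Q\<close>; as
    finitely many coordinates are involved, the product formula holds almost surely.\<close>
  have AE: "AE x in P. asset_price M g s\<^sub>0 \<sigma> T N N x = s\<^sub>0 * exp (log_return a N x)"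
  proof -
    have "AE x in P. \<forall>i\<in>{1..N}. enn2real (RN_deriv M (measure_path M g a) (x i)) = 1 + a * g (x i)"
      unfolding P_def Q_def
      by (intro eventually_ball_finite ballI
          AE_PiM_component[where P = "\<lambda>y. enn2real (RN_deriv M (measure_path M g a) y) = 1 + a * g y"]
          AE_path RN_deriv_path prob_space_path a a1 b) auto
    then show ?thesis
    proof eventually_elim
      case (elim x)
      then show ?case
        unfolding asset_price_def exp_log_return
        by (simp add: a_def market_exposure_def)
    qed
  qed
  have payoff: "max (S - K) 0 = S - K + max (K - S) 0" for S :: real by simp
  have int_one: "integrable Q (\<lambda>x. 1 + a * g x)"
    unfolding Q_def by (rule mean_price_ratio[OF b])
  have int_exp: "integrable P (\<lambda>x. exp (log_return a N x))"
    unfolding exp_log_return P_def by (rule P.product_integrable_prod) (use int_one in auto)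
  have "(LINT x|P. exp (log_return a N x)) = (\<Prod>i\<in>{1..N}. LINT x|Q. 1 + a * g x)"
    unfolding exp_log_return P_def by (rule P.product_integral_prod) (use int_one in auto)
  also have "\<dots> = exp (r * T)"
    using N by (simp add: Q_def mean_price_ratio(2)[OF b] ab flip: exp_of_nat_mult)
  finally have mean: "(LINT x|P. exp (log_return a N x)) = exp (r * T)" .
  have int_put: "integrable P (\<lambda>x. max (K - s\<^sub>0 * exp (log_return a N x)) 0)"
    using int_exp by (intro integrable_max) auto
  have "option_price M g \<sigma> T r N (call_payoff M g s\<^sub>0 \<sigma> T K N)
      = (LINT x|P. exp (- r * T) * call_payoff M g s\<^sub>0 \<sigma> T K N x)"
    by (simp add: option_price_def martingale_measure_def one_period_martingale_measure_def
        bond P_def Q_def b_def martingale_tilt_def exp_minus)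
  also have "\<dots> = exp (- r * T) * (LINT x|P. call_payoff M g s\<^sub>0 \<sigma> T K N x)"
    by (rule integral_mult_right_zero)
  also have "(LINT x|P. call_payoff M g s\<^sub>0 \<sigma> T K N x)
      = (LINT x|P. s\<^sub>0 * exp (log_return a N x) - K + max (K - s\<^sub>0 * exp (log_return a N x)) 0)"
  proof (rule integral_cong_AE)
    have [measurable]: "(\<lambda>x. x i) \<in> measurable P M" if "i \<in> {1..N}" for i
      using measurable_component_singleton[OF that, of "\<lambda>_. Q"]
      unfolding P_def Q_def by (simp cong: measurable_cong_sets)
    show "call_payoff M g s\<^sub>0 \<sigma> T K N \<in> borel_measurable P"
      unfolding call_payoff_def asset_price_def by measurable
    show "AE x in P. call_payoff M g s\<^sub>0 \<sigma> T K N x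
        = s\<^sub>0 * exp (log_return a N x) - K + max (K - s\<^sub>0 * exp (log_return a N x)) 0"
      using AE by eventually_elim (simp add: call_payoff_def)
  qed measurable
  also have "\<dots> = s\<^sub>0 * exp (r * T) - K + (LINT x|P. max (K - s\<^sub>0 * exp (log_return a N x)) 0)"
    using int_exp int_put by (simp add: mean P'.prob_space)
  finally show ?thesis
    by (simp add: P_def Q_def algebra_simps flip: exp_add mult.assoc)
qed

theorem call_price_tendsto_black_scholes:
  fixes \<sigma> T r s\<^sub>0 K :: real
  assumes pos: "T > 0" "\<sigma> > 0" "r \<ge> 0" "s\<^sub>0 > 0" "K > 0"
  shows "(\<lambda>N. option_price M g \<sigma> T r N (call_payoff M g s\<^sub>0 \<sigma> T K N))
    \<longlonglongrightarrow> black_scholes_call_price s\<^sub>0 \<sigma> T r K"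
proof -
  define s where "s = \<sigma> * sqrt T"
  define m where "m = r * T - s\<^sup>2 / 2"
  define a where "a = market_exposure \<sigma> T"
  define b where "b = martingale_tilt \<sigma> T r"
  have s: "s > 0" using pos by (simp add: s_def)
  have a_nn: "0 \<le> a N" for N using pos by (simp add: a_def market_exposure_def)
  have rate_nn: "0 \<le> interest_rate T r N" for N using pos by (simp add: interest_rate_def)
  then have b_nn: "0 \<le> b N" for N using pos by (simp add: b_def martingale_tilt_def)
  have rate: "(\<lambda>N. interest_rate T r N) \<longlonglongrightarrow> r"
    unfolding interest_rate_def using pos(1) by real_asymp
  have sqrt_N: "(\<lambda>N. 1 / sqrt (real N)) \<longlonglongrightarrow> 0" by real_asymp
  have a_lim: "a \<longlonglongrightarrow> 0"
    using tendsto_mult_left[OF sqrt_N, of s]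
    by (simp add: a_def market_exposure_def[abs_def] s_def)
  have b_lim: "b \<longlonglongrightarrow> 0"
    using tendsto_mult[OF tendsto_mult_left[OF rate, of "sqrt T / \<sigma>"] sqrt_N]
    by (simp add: b_def martingale_tilt_def[abs_def] mult_ac)
  have "eventually (\<lambda>N. a N * C < 1/2) sequentially" "eventually (\<lambda>N. b N * C < 1) sequentially"
    by (rule order_tendstoD[OF tendsto_mult_left_zero[OF a_lim, of C]], simp,
        rule order_tendstoD[OF tendsto_mult_left_zero[OF b_lim, of C]], simp)
  then have "eventually (\<lambda>N. a N * C \<le> 1/2 \<and> b N * C \<le> 1 \<and> N > 0) sequentially"
    using eventually_gt_at_top[of 0] by eventually_elim auto
  then obtain N\<^sub>0 where N0: "a N * C \<le> 1/2" "b N * C \<le> 1" "N > 0" if "N \<ge> N\<^sub>0" for N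
    by (auto simp: eventually_sequentially)
  \<comment> \<open>Levy's theorem needs every term of the sequence to be a probability distribution, so the
    finitely many stages at which the path leaves its admissible range are skipped.\<close>
  define k where "k n = n + N\<^sub>0" for n
  have k: "filterlim k at_top sequentially"
    unfolding k_def by (rule filterlim_add_const_nat_at_top)
  have large: "a (k n) * C \<le> 1/2" "b (k n) * C \<le> 1" "k n > 0" for n
    using N0[of "k n"] by (auto simp: k_def)
  have var: "k n * (a (k n))\<^sup>2 = s\<^sup>2" for n
    using large(3)[of n] by (simp add: a_def market_exposure_def s_def power_divide)
  have "k n * (a (k n) * b (k n)) = interest_rate T r (k n) * T" for n
    using large(3)[of n] pos
    by (simp add: a_def b_def market_exposure_def martingale_tilt_def field_simps)
  then have drift: "(\<lambda>n. k n * (a (k n) * b (k n))) \<longlonglongrightarrow> r * T"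
    using tendsto_mult_right[OF filterlim_compose[OF rate k], of T] by simp
  define P where "P n = (\<Pi>\<^sub>M j\<in>{1..k n}. measure_path M g (b (k n)))" for n
  define \<mu> where "\<mu> n = distr (P n) borel (log_return (a (k n)) (k n))" for n
  define \<nu> where "\<nu> = distr std_normal_distribution borel (\<lambda>z. m + s * z)"
  have [measurable]: "log_return (a (k n)) (k n) \<in> borel_measurable (P n)" for n
    unfolding P_def by measurable
  have weak: "weak_conv_m \<mu> \<nu>"
    unfolding \<mu>_def \<nu>_def P_def m_def
    by (rule log_return_weak_conv[OF a_nn large(1) filterlim_compose[OF a_lim k] b_nn large(2) k])
       (simp_all only: var drift tendsto_const)
  have \<mu>: "real_distribution (\<mu> n)" for n
  proof -
    interpret P: product_prob_space "\<lambda>_::nat. measure_path M g (b (k n))" "{1..k n}"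
      by (rule product_path[OF b_nn large(2)])
    show ?thesis unfolding \<mu>_def P_def by (rule P.P.real_distribution_distr) measurable
  qed
  have \<nu>: "real_distribution \<nu>"
  proof -
    interpret N: real_distribution std_normal_distribution by (rule real_dist_normal_dist)
    show ?thesis unfolding \<nu>_def by (rule N.real_distribution_distr) measurable
  qed
  define put where "put y = max (K - s\<^sub>0 * exp y) 0" for y
  have [measurable]: "put \<in> borel_measurable borel" unfolding put_def by measurable
  have "(\<lambda>n. integral\<^sup>L (\<mu> n) put) \<longlonglongrightarrow> integral\<^sup>L \<nu> put"
  proof (rule weak_conv_imp_integral_bdd_continuous_conv[OF \<mu> \<nu> weak])
    show "isCont put y" for y unfolding put_def by (intro continuous_intros)
    show "norm (put y) \<le> K" for y using pos by (auto simp: put_def)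
  qed
  moreover have "integral\<^sup>L (\<mu> n) put
      = (LINT x|P n. max (K - s\<^sub>0 * exp (log_return (a (k n)) (k n) x)) 0)" for n
    unfolding \<mu>_def by (subst integral_distr) (simp_all add: put_def)
  moreover have "integral\<^sup>L \<nu> put = (LINT z|std_normal_distribution. max (K - s\<^sub>0 * exp (m + s * z)) 0)"
    unfolding \<nu>_def by (subst integral_distr) (simp_all add: put_def)
  ultimately have "(\<lambda>n. LINT x|P n. max (K - s\<^sub>0 * exp (log_return (a (k n)) (k n) x)) 0)
      \<longlonglongrightarrow> (LINT z|std_normal_distribution. max (K - s\<^sub>0 * exp (m + s * z)) 0)"
    by simp
  then have limit: "(\<lambda>n. s\<^sub>0 - exp (- r * T) * K
        + exp (- r * T) * (LINT x|P n. max (K - s\<^sub>0 * exp (log_return (a (k n)) (k n) x)) 0))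
      \<longlonglongrightarrow> s\<^sub>0 - exp (- r * T) * K
        + exp (- r * T) * (LINT z|std_normal_distribution. max (K - s\<^sub>0 * exp (m + s * z)) 0)"
    by (intro tendsto_intros)
  have price: "option_price M g \<sigma> T r (n + N\<^sub>0) (call_payoff M g s\<^sub>0 \<sigma> T K (n + N\<^sub>0))
      = s\<^sub>0 - exp (- r * T) * K
        + exp (- r * T) * (LINT x|P n. max (K - s\<^sub>0 * exp (log_return (a (k n)) (k n) x)) 0)" for n
    using call_price_eq[of "k n" T \<sigma> s\<^sub>0 r K] pos a_nn[of "k n"] b_nn[of "k n"] large[of n]
    by (simp add: P_def k_def a_def b_def)
  have limit_value: "s\<^sub>0 - exp (- r * T) * K
        + exp (- r * T) * (LINT z|std_normal_distribution. max (K - s\<^sub>0 * exp (m + s * z)) 0)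
      = black_scholes_call_price s\<^sub>0 \<sigma> T r K"
  proof -
    define x where "x = 1 / (\<sigma> * sqrt T) * (ln (K / s\<^sub>0) - r * T + \<sigma>\<^sup>2 / 2 * T)"
    have x: "x = (ln (K / s\<^sub>0) - m) / s"
      using pos by (simp add: x_def m_def s_def power_mult_distrib)
    have disc: "exp (- r * T) * exp (m + s\<^sup>2 / 2) = 1" by (simp add: m_def flip: exp_add)
    have "s\<^sub>0 - exp (- r * T) * K
        + exp (- r * T) * (K * std_normal_cdf x - s\<^sub>0 * exp (m + s\<^sup>2 / 2) * std_normal_cdf (x - s))
      = s\<^sub>0 - exp (- r * T) * K * (1 - std_normal_cdf x)
        - s\<^sub>0 * (exp (- r * T) * exp (m + s\<^sup>2 / 2)) * std_normal_cdf (x - s)"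
      by (simp only: ring_distribs mult_ac)
    also have "\<dots> = s\<^sub>0 * (1 - std_normal_cdf (x - s)) - exp (- r * T) * K * (1 - std_normal_cdf x)"
      unfolding disc by (simp add: algebra_simps)
    also have "\<dots> = s\<^sub>0 * std_normal_cdf (- x + s) - exp (- r * T) * K * std_normal_cdf (- x)"
      using std_normal_cdf_uminus[of "x - s"] std_normal_cdf_uminus[of x] by simp
    also have "\<dots> = black_scholes_call_price s\<^sub>0 \<sigma> T r K"
      by (simp add: black_scholes_call_price_def Let_def x_def s_def)
    finally show ?thesis
      using lognormal_put_value[OF s, of s\<^sub>0 K m] pos by (simp add: x)
  qed
  show ?thesis
  proof (rule LIMSEQ_offset)
    show "(\<lambda>n. option_price M g \<sigma> T r (n + N\<^sub>0) (call_payoff M g s\<^sub>0 \<sigma> T K (n + N\<^sub>0)))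
        \<longlonglongrightarrow> black_scholes_call_price s\<^sub>0 \<sigma> T r K"
      unfolding price by (rule limit[unfolded limit_value])
  qed
qed

end

text \<open>Prices see \<open>g\<close> only through the measures of the path, so \<open>g\<close> may be altered on a null
  set. In particular a lower bound that holds almost everywhere can be made to hold everywhere.\<close>

lemma measure_path_cong:
  assumes [measurable]: "g \<in> borel_measurable P\<^sub>0" "h \<in> borel_measurable P\<^sub>0"
    and "AE x in P\<^sub>0. g x = h x"
  shows "measure_path P\<^sub>0 g = measure_path P\<^sub>0 h"
proof
  fix \<theta>
  show "measure_path P\<^sub>0 g \<theta> = measure_path P\<^sub>0 h \<theta>"
    unfolding measure_path_def
    by (rule density_cong) (use assms(3) in \<open>auto elim: eventually_mono\<close>)
qed

theorem corollary6p8: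
  fixes P\<^sub>0 :: "'a measure" and g :: "'a \<Rightarrow> real" and C T \<sigma> r s\<^sub>0 K :: real
  assumes "prob_space P\<^sub>0"
    and "g \<in> borel_measurable P\<^sub>0" and "integrable P\<^sub>0 (\<lambda>x. (g x)\<^sup>2)"
    and "(LINT x | P\<^sub>0. g x) = 0" and "(LINT x | P\<^sub>0. (g x)\<^sup>2) = 1"
    and "C > 0" and "AE x in P\<^sub>0. g x > - C"
    and "T > 0" and "\<sigma> > 0" and "r \<ge> 0" and "s\<^sub>0 > 0" and "K > 0"
  shows "(\<lambda>N. option_price P\<^sub>0 g \<sigma> T r N (call_payoff P\<^sub>0 g s\<^sub>0 \<sigma> T K N))
           \<longlonglongrightarrow> black_scholes_call_price s\<^sub>0 \<sigma> T r K"
proof -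
  define h where "h x = max (g x) (- C)" for x
  note [measurable] = assms(2)
  have h [measurable]: "h \<in> borel_measurable P\<^sub>0" unfolding h_def by measurable
  have AE: "AE x in P\<^sub>0. g x = h x" using assms(7) by eventually_elim (simp add: h_def)
  have path: "measure_path P\<^sub>0 g = measure_path P\<^sub>0 h"
    using assms(2) h AE by (rule measure_path_cong)
  interpret score P\<^sub>0 h C
  proof (intro score.intro score_axioms.intro)
    have "AE x in P\<^sub>0. (g x)\<^sup>2 = (h x)\<^sup>2" using AE by eventually_elim simp
    then have "integrable P\<^sub>0 (\<lambda>x. (g x)\<^sup>2) \<longleftrightarrow> integrable P\<^sub>0 (\<lambda>x. (h x)\<^sup>2)"
      "(LINT x | P\<^sub>0. (g x)\<^sup>2) = (LINT x | P\<^sub>0. (h x)\<^sup>2)"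
      by (intro integrable_cong_AE integral_cong_AE; measurable)+
    then show "integrable P\<^sub>0 (\<lambda>x. (h x)\<^sup>2)" "(LINT x | P\<^sub>0. (h x)\<^sup>2) = 1" using assms by auto
    have "(LINT x | P\<^sub>0. g x) = (LINT x | P\<^sub>0. h x)" using AE by (auto intro!: integral_cong_AE)
    then show "(LINT x | P\<^sub>0. h x) = 0" using assms by simp
  qed (use assms(1) h in \<open>auto simp: h_def\<close>)
  have "(\<lambda>N. option_price P\<^sub>0 h \<sigma> T r N (call_payoff P\<^sub>0 h s\<^sub>0 \<sigma> T K N))
      \<longlonglongrightarrow> black_scholes_call_price s\<^sub>0 \<sigma> T r K"
    using assms(8-12) by (rule call_price_tendsto_black_scholes)
  then show ?thesis
    by (simp add: option_price_def martingale_measure_def one_period_martingale_measure_def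
        call_payoff_def asset_price_def path)
qed

end
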